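(* Let $u$ be a global convex (Alexandrov) solution of $$\det D^2u=\sum_{z\in\mathbb{Z}^n}\delta_z\quad\text{in }\mathbb{R}^n,$$ written as $u(x)=v(x)+\frac12x^{\top}Ax+b\cdot x+c$ with $v$ a $\mathbb{Z}^n$-periodic function, $A$ a positive definite symmetric $n\times n$ matrix, $b\in\mathbb{R}^n$ and $c\in\mathbb{R}$, and set $\Gamma:=A^{1/2}\mathbb{Z}^n$. Then the family $\{\partial u(z)\}_{z\in\mathbb{Z}^n}$ forms a tiling of $\mathbb{R}^n$ that is periodic under translations by $A\mathbb{Z}^n$, and each tile is a translate of $A^{1/2}\operatorname{Vor}_\Gamma(0)$.
   Context: $\delta_z$ is the Dirac mass at $z$. A convex function $u$ on $\mathbb{R}^n$ is an Alexandrov solution of $\det D^2u=\mu$ if $|\partial u(E)|=\mu(E)$ for all Borel $E$, where $\partial u$ is the subdifferential. Every global convex solution of the equation above admits a decomposition of the stated form (with $\det A=1$), and $A$ is determined by $u$. For an $n$-dimensional lattice $\Gamma$ and $\xi\in\Gamma$, the Dirichlet-Voronoi polytope is $\operatorname{Vor}_\Gamma(\xi)=\{x\in\mathbb{R}^n:|x-\xi|\le|x-\tilde\xi|\ \ \forall\tilde\xi\in\Gamma\}$. A family of convex bodies forms a tiling of $\mathbb{R}^n$ if it covers $\mathbb{R}^n$ and distinct members have disjoint interiors. *)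

theory Defs
  imports "HOL-Probability.Probability"
begin

definition integer_lattice :: "(real^'n) set" where
  "integer_lattice = {z. \<forall>i. z $ i \<in> \<int>}"

definition subdifferential :: "('a::real_inner \<Rightarrow> real) \<Rightarrow> 'a \<Rightarrow> 'a set" where
  "subdifferential u x = {p. \<forall>y. u y \<ge> u x + p \<bullet> (y - x)}"

definition dirac_sum :: "'a::topological_space set \<Rightarrow> 'a measure" where
  "dirac_sum S = measure_of UNIV (sets borel)
     (\<lambda>E. \<integral>\<^sup>+ z. emeasure (return borel z) E \<partial>count_space S)"

lemma sets_dirac_sum [simp]: "sets (dirac_sum S) = sets borel"
  unfolding dirac_sum_def using sets.sigma_sets_eq[of borel]
  by (subst sets_measure_of) auto

lemma emeasure_dirac_sum:
  assumes "E \<in> sets borel"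
  shows "emeasure (dirac_sum S) E = (\<integral>\<^sup>+ z. emeasure (return borel z) E \<partial>count_space S)"
  unfolding dirac_sum_def
proof (rule emeasure_measure_of_sigma)
  show "sigma_algebra UNIV (sets (borel :: 'a measure))"
    using sets.sigma_algebra_axioms[of "borel :: 'a measure"] by simp
  show "positive (sets borel) (\<lambda>E. \<integral>\<^sup>+ z. emeasure (return borel z) E \<partial>count_space S)"
    by (simp add: positive_def)
  show "countably_additive (sets borel)
      (\<lambda>E. \<integral>\<^sup>+ z. emeasure (return borel z) E \<partial>count_space S)"
  proof (rule countably_additiveI)
    fix F :: "nat \<Rightarrow> 'a set"
    assume F: "range F \<subseteq> sets borel" "disjoint_family F"
    have "(\<Sum>i. \<integral>\<^sup>+ z. emeasure (return borel z) (F i) \<partial>count_space S)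
        = (\<integral>\<^sup>+ z. (\<Sum>i. emeasure (return borel z) (F i)) \<partial>count_space S)"
      by (rule nn_integral_suminf[symmetric]) simp
    also have "\<dots> = (\<integral>\<^sup>+ z. emeasure (return borel z) (\<Union>i. F i) \<partial>count_space S)"
      using F by (intro nn_integral_cong suminf_emeasure) auto
    finally show "(\<Sum>i. \<integral>\<^sup>+ z. emeasure (return borel z) (F i) \<partial>count_space S)
        = (\<integral>\<^sup>+ z. emeasure (return borel z) (\<Union>i. F i) \<partial>count_space S)" .
  qed
qed (use assms in auto)

text \<open>The image of a Borel set under the subdifferential of a finite convex function is
  Lebesgue measurable (though not Borel in general), so its size is taken in \<^const>\<open>lebesgue\<close>.\<close>

definition alexandrov_solution :: "('a::euclidean_space \<Rightarrow> real) \<Rightarrow> 'a measure \<Rightarrow> bool" where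
  "alexandrov_solution u \<mu> \<longleftrightarrow> convex_on UNIV u \<and>
     (\<forall>E\<in>sets borel. emeasure lebesgue (\<Union>x\<in>E. subdifferential u x) = emeasure \<mu> E)"

definition sym_pos_def :: "real^'n^'n \<Rightarrow> bool" where
  "sym_pos_def A \<longleftrightarrow> transpose A = A \<and> (\<forall>x. x \<noteq> 0 \<longrightarrow> x \<bullet> (A *v x) > 0)"

text \<open>Meaningful when \<open>A\<close> is symmetric positive definite: the positive definite square root
  then exists and is unique.\<close>

definition matrix_sqrt :: "real^'n^'n \<Rightarrow> real^'n^'n" where
  "matrix_sqrt A = (THE B. sym_pos_def B \<and> B ** B = A)"

definition voronoi :: "'a::real_inner set \<Rightarrow> 'a \<Rightarrow> 'a set" where
  "voronoi \<Gamma> \<xi> = {x. \<forall>\<eta>\<in>\<Gamma>. norm (x - \<xi>) \<le> norm (x - \<eta>)}"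

definition convex_body :: "'a::euclidean_space set \<Rightarrow> bool" where
  "convex_body K \<longleftrightarrow> convex K \<and> compact K \<and> interior K \<noteq> {}"

definition is_tiling :: "'i set \<Rightarrow> ('i \<Rightarrow> 'a::euclidean_space set) \<Rightarrow> bool" where
  "is_tiling I T \<longleftrightarrow> (\<forall>i\<in>I. convex_body (T i)) \<and> (\<Union>i\<in>I. T i) = UNIV \<and>
     (\<forall>i\<in>I. \<forall>j\<in>I. i \<noteq> j \<longrightarrow> interior (T i) \<inter> interior (T j) = {})"

definition translation_periodic :: "'a::ab_group_add set set \<Rightarrow> 'a set \<Rightarrow> bool" where
  "translation_periodic \<T> L \<longleftrightarrow> (\<forall>t\<in>L. (\<lambda>K. (+) t ` K) ` \<T> = \<T>)"

end

theory Submission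
  imports Defs
begin

text \<open>Write \<open>L\<close> for the integer lattice. Three facts determine the tiles.

  Restricted to \<open>L\<close>, the function \<open>u\<close> is an affine function plus \<open>x \<bullet> A x / 2\<close>, because the
  periodic part is constant there. So the slopes \<open>p\<close> that support \<open>u\<close> at \<open>z \<in> L\<close> when tested
  only against lattice points form an explicit polytope, the translate by \<open>b + A z\<close> of
  \<open>{q. q \<bullet> w \<le> w \<bullet> A w / 2 for all w \<in> L}\<close>. Substituting \<open>q = B y\<close> with \<open>B\<close> the square root of
  \<open>A\<close> turns its inequalities into \<open>norm y \<le> norm (y - B w)\<close>, so this polytope is the image under
  \<open>B\<close> of the Dirichlet-Voronoi cell (\<open>voronoi_cell_eq_image\<close>). For this, \<open>B\<close> must
  exist and be unique; existence comes from the spectral theorem.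

  These polytopes cover the space, since \<open>u\<close> grows quadratically and \<open>u - p\<close> therefore attains
  its minimum over \<open>L\<close>, and their interiors are disjoint, since moving a common slope in the
  direction \<open>w - z\<close> favours \<open>w\<close> over \<open>z\<close>.

  Finally, the tile \<open>subdifferential u z\<close>, which is contained in the polytope of \<open>z\<close>, is all of
  it (\<open>subdifferential_eq_on\<close>). The minimum of \<open>u - p\<close> over the whole space is also attained, so
  every slope supports \<open>u\<close> somewhere. The equation says that the slopes supporting \<open>u\<close> outside
  \<open>L\<close> form a set of measure zero. Hence almost every slope lies in some tile, and for a slope
  in the interior of the polytope of \<open>z\<close> this can only be the tile of \<open>z\<close>. So the tile is
  dense in its polytope, and it is closed.\<close>

section \<open>The positive definite square root\<close>

lemma symmetric_matrix_inner:
  fixes A :: "real^'n^'n"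
  assumes "transpose A = A"
  shows "x \<bullet> (A *v y) = (A *v x) \<bullet> y"
  by (metis assms dot_lmul_matrix vector_transpose_matrix)

lemma symmetric_matrixI:
  fixes A :: "real^'n^'n"
  assumes "\<And>x y. x \<bullet> (A *v y) = (A *v x) \<bullet> y"
  shows "transpose A = A"
proof -
  have "x \<bullet> (transpose A *v y - A *v y) = 0" for x y
    using assms[of x y] dot_lmul_matrix[of y A x]
    by (simp add: inner_diff_right inner_commute)
  then have "transpose A *v y = A *v y" for y
    by (metis inner_eq_zero_iff right_minus_eq)
  then show ?thesis by (simp add: matrix_eq)
qed

text \<open>A maximiser \<open>x\<close> of the Rayleigh quotient is an eigenvector: the residual
  \<open>r = f x - m x\<close> lies in \<open>S\<close>, and if it were nonzero the quotient would grow along \<open>r\<close>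
  to first order, at rate proportional to \<open>r \<bullet> r\<close>.\<close>

lemma self_adjoint_eigenvector:
  fixes f :: "'a::euclidean_space \<Rightarrow> 'a"
  assumes lin: "linear f" and adj: "\<And>x y. x \<bullet> f y = f x \<bullet> y"
    and S: "subspace S" "S \<noteq> {0}" and inv: "f ` S \<subseteq> S"
  obtains x m where "x \<in> S" "norm x = 1" "f x = m *\<^sub>R x"
proof -
  interpret linear f by (rule lin)
  have "compact (S \<inter> sphere 0 1)"
    using closed_subspace[OF S(1)] by (intro closed_Int_compact) auto
  moreover have "S \<inter> sphere 0 1 \<noteq> {}"
  proof -
    obtain y where "y \<in> S" "y \<noteq> 0" using S subspace_0 by blast
    then have "(1 / norm y) *\<^sub>R y \<in> S \<inter> sphere 0 1"
      using S(1) by (auto simp: subspace_scale)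
    then show ?thesis by blast
  qed
  moreover have "continuous_on (S \<inter> sphere 0 1) (\<lambda>y. y \<bullet> f y)"
    using lin by (intro continuous_intros linear_continuous_on linear_conv_bounded_linear[THEN iffD1])
  ultimately have "\<exists>x\<in>S \<inter> sphere 0 1. \<forall>y\<in>S \<inter> sphere 0 1. y \<bullet> f y \<le> x \<bullet> f x"
    by (rule continuous_attains_sup)
  then obtain x where x: "x \<in> S" "norm x = 1"
    and max: "\<And>y. y \<in> S \<Longrightarrow> norm y = 1 \<Longrightarrow> y \<bullet> f y \<le> x \<bullet> f x"
    by auto
  define m where "m = x \<bullet> f x"
  have bound: "y \<bullet> f y \<le> m * (y \<bullet> y)" if "y \<in> S" for y
  proof (cases "y = 0")
    case False
    have "((1 / norm y) *\<^sub>R y) \<bullet> f ((1 / norm y) *\<^sub>R y) \<le> m"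
      unfolding m_def using that False S(1) by (intro max) (auto simp: subspace_scale)
    then have "y \<bullet> f y / (norm y)\<^sup>2 \<le> m"
      by (simp add: scaleR power2_eq_square)
    then show ?thesis
      using False by (simp add: field_simps power2_norm_eq_inner)
  qed simp
  have xx: "x \<bullet> x = 1" using x by (simp add: norm_eq_1)
  define r where "r = f x - m *\<^sub>R x"
  have rS: "r \<in> S"
    unfolding r_def using inv x(1) by (intro subspace_diff[OF S(1)] subspace_scale[OF S(1)]) blast+
  have rx: "r \<bullet> x = 0"
    unfolding r_def m_def by (simp add: inner_diff_left xx inner_commute[of "f x"])
  have "r \<bullet> r = r \<bullet> f x - m * (r \<bullet> x)"
    by (subst (2) r_def) (simp add: inner_diff_right)
  then have rfx: "r \<bullet> f x = r \<bullet> r" by (simp add: rx)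
  have key: "2 * t * (r \<bullet> r) \<le> t\<^sup>2 * (m * (r \<bullet> r) - r \<bullet> f r)" for t
  proof -
    have "(x + t *\<^sub>R r) \<bullet> f (x + t *\<^sub>R r) \<le> m * ((x + t *\<^sub>R r) \<bullet> (x + t *\<^sub>R r))"
      by (rule bound[OF subspace_add[OF S(1) x(1) subspace_scale[OF S(1) rS]]])
    moreover have "x \<bullet> f r = r \<bullet> r" using adj[of x r] rfx inner_commute[of r "f x"] by linarith
    moreover have "x \<bullet> f x = m" by (simp add: m_def)
    moreover have "x \<bullet> r = 0" using rx inner_commute[of r x] by linarith
    moreover note rx rfx xx
    ultimately show ?thesis
      by (simp add: add scaleR inner_add_left inner_add_right algebra_simps power2_eq_square)
  qed
  have "r \<bullet> r = 0"
  proof (rule ccontr)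
    assume "r \<bullet> r \<noteq> 0"
    then have pos: "r \<bullet> r > 0" using inner_ge_zero[of r] by linarith
    define d where "d = \<bar>m * (r \<bullet> r) - r \<bullet> f r\<bar> + r \<bullet> r"
    have d: "d > 0" "d \<ge> m * (r \<bullet> r) - r \<bullet> f r" using pos unfolding d_def by linarith+
    \<comment> \<open>Any step shorter than \<open>2 * (r \<bullet> r) / d\<close> makes the linear gain exceed the quadratic loss.\<close>
    define t where "t = (r \<bullet> r) / d"
    have t: "t > 0" using d pos by (simp add: t_def)
    have "2 * (r \<bullet> r) \<le> t * (m * (r \<bullet> r) - r \<bullet> f r)"
      using key[of t] t by (simp add: power2_eq_square mult.assoc)
    also have "\<dots> \<le> t * d" using t d by (intro mult_left_mono) auto
    also have "\<dots> = r \<bullet> r" using d by (simp add: t_def)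
    finally show False using pos by linarith
  qed
  then have "f x = m *\<^sub>R x" by (simp add: r_def)
  then show thesis using that x by blast
qed

text \<open>The spectral theorem, by splitting off one eigenvector at a time; invariance of the
  orthogonal complement of an eigenvector is where self-adjointness enters.\<close>

lemma self_adjoint_eigenbasis:
  fixes f :: "'a::euclidean_space \<Rightarrow> 'a"
  assumes lin: "linear f" and adj: "\<And>x y. x \<bullet> f y = f x \<bullet> y"
    and "subspace S" and "f ` S \<subseteq> S"
  shows "\<exists>W ev. finite W \<and> W \<subseteq> S \<and> (\<forall>w\<in>W. norm w = 1 \<and> f w = ev w *\<^sub>R w) \<and>
    pairwise orthogonal W \<and> (\<forall>x\<in>S. x = (\<Sum>w\<in>W. (w \<bullet> x) *\<^sub>R w))"
  using assms(3,4)
proof (induction "dim S" arbitrary: S rule: less_induct)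
  case less
  show ?case
  proof (cases "S = {0}")
    case True
    then show ?thesis by (intro exI[of _ "{}"]) auto
  next
    case False
    obtain e m where e: "e \<in> S" "norm e = 1" "f e = m *\<^sub>R e"
      using self_adjoint_eigenvector[OF lin adj less.prems(1) False less.prems(2)] by blast
    have ee: "e \<bullet> e = 1" using e by (simp add: norm_eq_1)
    define S' where "S' = S \<inter> {x. e \<bullet> x = 0}"
    have sub: "subspace S'"
      unfolding S'_def using less.prems(1) by (intro subspace_inter subspace_hyperplane)
    have inv: "f ` S' \<subseteq> S'"
      using less.prems(2) e(3) adj[of e] by (auto simp: S'_def)
    have "e \<notin> S'" using ee by (simp add: S'_def)
    then have "S' \<subset> S" using e(1) unfolding S'_def by blast
    then have "span S' \<subset> span S" using sub less.prems(1) by (metis span_eq_iff)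
    then have "dim S' < dim S" by (rule dim_psubset)
    from less.hyps[OF this sub inv] obtain W ev where W: "finite W" "W \<subseteq> S'"
      "\<And>w. w \<in> W \<Longrightarrow> norm w = 1 \<and> f w = ev w *\<^sub>R w" "pairwise orthogonal W"
      and exp: "\<And>x. x \<in> S' \<Longrightarrow> x = (\<Sum>w\<in>W. (w \<bullet> x) *\<^sub>R w)" by blast
    have We: "e \<bullet> w = 0" "w \<bullet> e = 0" if "w \<in> W" for w
      using W(2) that by (auto simp: S'_def inner_commute)
    have eW: "e \<notin> W" using We ee by force
    have "x = (\<Sum>w\<in>insert e W. (w \<bullet> x) *\<^sub>R w)" if "x \<in> S" for x
    proof -
      have "x - (e \<bullet> x) *\<^sub>R e \<in> S'"
        using that e less.prems(1)
        by (auto simp: S'_def inner_diff_right ee intro!: subspace_diff subspace_scale)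
      then have "x - (e \<bullet> x) *\<^sub>R e = (\<Sum>w\<in>W. (w \<bullet> (x - (e \<bullet> x) *\<^sub>R e)) *\<^sub>R w)" by (rule exp)
      also have "\<dots> = (\<Sum>w\<in>W. (w \<bullet> x) *\<^sub>R w)"
        by (intro sum.cong refl) (simp add: inner_diff_right We)
      finally show ?thesis using W(1) eW by (simp add: algebra_simps)
    qed
    moreover have "pairwise orthogonal (insert e W)"
      using W(4) We by (auto simp: pairwise_insert orthogonal_def)
    moreover have "\<forall>w\<in>insert e W. norm w = 1 \<and> f w = (ev(e := m)) w *\<^sub>R w"
      using W(3) e eW by auto
    moreover have "insert e W \<subseteq> S" using W(2) e by (auto simp: S'_def)
    ultimately show ?thesis using W(1)
      by (intro exI[of _ "insert e W"] exI[of _ "ev(e := m)"]) auto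
  qed
qed

text \<open>The square root acts on each eigenvector \<open>w\<close> by the root of its eigenvalue.\<close>

lemma sym_pos_def_sqrt_exists:
  fixes A :: "real^'n^'n"
  assumes "sym_pos_def A"
  shows "\<exists>B. sym_pos_def B \<and> B ** B = A"
proof -
  have A: "transpose A = A" "\<And>x. x \<noteq> 0 \<Longrightarrow> x \<bullet> (A *v x) > 0"
    using assms by (auto simp: sym_pos_def_def)
  have "\<exists>W ev. finite W \<and> W \<subseteq> UNIV \<and> (\<forall>w\<in>W. norm w = 1 \<and> A *v w = ev w *\<^sub>R w) \<and>
    pairwise orthogonal W \<and> (\<forall>x\<in>UNIV. x = (\<Sum>w\<in>W. (w \<bullet> x) *\<^sub>R w))"
    using symmetric_matrix_inner[OF A(1)]
    by (intro self_adjoint_eigenbasis) (auto simp: matrix_vector_mul_linear)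
  then obtain W ev where W: "finite W" "\<And>w. w \<in> W \<Longrightarrow> norm w = 1"
    "\<And>w. w \<in> W \<Longrightarrow> A *v w = ev w *\<^sub>R w" "pairwise orthogonal W"
    and exp: "\<And>x. x = (\<Sum>w\<in>W. (w \<bullet> x) *\<^sub>R w)"
    by blast
  have ww: "w \<bullet> w = 1" if "w \<in> W" for w using W(2)[OF that] by (simp add: norm_eq_1)
  have ev: "ev w > 0" if "w \<in> W" for w
    using A(2)[of w] W(3)[OF that] ww[OF that] by force
  define g where "g x = (\<Sum>w\<in>W. (sqrt (ev w) * (w \<bullet> x)) *\<^sub>R w)" for x :: "real^'n"
  have lin: "linear g"
    by (rule linearI)
      (simp_all add: g_def inner_add_right algebra_simps sum.distrib scaleR_sum_right)
  define B where "B = matrix g"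
  have Bg: "B *v x = g x" for x by (simp add: B_def lin)
  have inner_g: "x \<bullet> g y = (\<Sum>w\<in>W. sqrt (ev w) * (w \<bullet> x) * (w \<bullet> y))" for x y
    by (simp add: g_def inner_sum_right inner_commute mult_ac)
  have wg: "w \<bullet> g x = sqrt (ev w) * (w \<bullet> x)" if "w \<in> W" for w x
  proof -
    have "w \<bullet> g x = (\<Sum>w'\<in>W. if w' = w then sqrt (ev w) * (w \<bullet> x) else 0)"
      unfolding inner_g using W(4) that ww
      by (intro sum.cong) (auto simp: pairwise_def orthogonal_def)
    then show ?thesis using W(1) that by simp
  qed
  have "transpose B = B"
    by (rule symmetric_matrixI) (simp add: Bg inner_g inner_commute[of "g _"] mult_ac)
  moreover have "x \<bullet> (B *v x) > 0" if "x \<noteq> 0" for x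
  proof -
    have "\<exists>w\<in>W. w \<bullet> x \<noteq> 0"
    proof (rule ccontr)
      assume "\<not> (\<exists>w\<in>W. w \<bullet> x \<noteq> 0)"
      then have "(\<Sum>w\<in>W. (w \<bullet> x) *\<^sub>R w) = 0" by simp
      then show False using trans[OF exp[of x]] that by blast
    qed
    then obtain w where w: "w \<in> W" "w \<bullet> x \<noteq> 0" by blast
    have "0 < sqrt (ev w) * (w \<bullet> x) * (w \<bullet> x)"
      using ev[OF w(1)] w(2) by (auto simp: mult.assoc zero_less_mult_iff linorder_neq_iff)
    then have "0 < (\<Sum>w\<in>W. sqrt (ev w) * (w \<bullet> x) * (w \<bullet> x))"
      using w(1) W(1) ev by (intro sum_pos2[of W w]) (auto simp: mult.assoc less_imp_le)
    then show ?thesis by (simp add: Bg inner_g)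
  qed
  moreover have "B ** B = A"
  proof -
    have "(B ** B) *v x = A *v x" for x
    proof -
      have "(B ** B) *v x = g (g x)"
        by (simp add: matrix_vector_mul_assoc[symmetric] Bg)
      also have "\<dots> = (\<Sum>w\<in>W. (sqrt (ev w) * (w \<bullet> g x)) *\<^sub>R w)"
        by (simp only: g_def[of "g x"])
      also have "\<dots> = (\<Sum>w\<in>W. (w \<bullet> x) *\<^sub>R (A *v w))"
      proof (intro sum.cong refl)
        fix w assume w: "w \<in> W"
        have "sqrt (ev w) * (sqrt (ev w) * (w \<bullet> x)) = ev w * (w \<bullet> x)"
          using ev[OF w] by (simp flip: mult.assoc)
        then show "(sqrt (ev w) * (w \<bullet> g x)) *\<^sub>R w = (w \<bullet> x) *\<^sub>R (A *v w)"
          by (simp add: wg[OF w] W(3)[OF w] mult.commute)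
      qed
      also have "\<dots> = A *v (\<Sum>w\<in>W. (w \<bullet> x) *\<^sub>R w)"
        by (simp add: linear_sum[OF matrix_vector_mul_linear] matrix_vector_mult_scaleR)
      also have "(\<Sum>w\<in>W. (w \<bullet> x) *\<^sub>R w) = x" by (rule exp[symmetric])
      finally show ?thesis .
    qed
    then show ?thesis by (simp add: matrix_eq)
  qed
  ultimately show ?thesis by (auto simp: sym_pos_def_def)
qed

text \<open>If \<open>D = B - C\<close> then \<open>B D + D C = B\<^sup>2 - C\<^sup>2 = 0\<close>. Multiplying by \<open>D\<close> from the left and
  rotating the second product under the trace shows that \<open>D B D\<close> and \<open>D C D\<close> have opposite
  traces. Both have nonnegative diagonals, so both traces vanish, and positivity of \<open>B\<close> kills
  every column of \<open>D\<close>.\<close>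

lemma sym_pos_def_sqrt_unique:
  fixes B C :: "real^'n^'n"
  assumes "sym_pos_def B" "sym_pos_def C" and eq: "B ** B = C ** C"
  shows "B = C"
proof -
  define D where "D = B - C"
  have pos: "x \<noteq> 0 \<Longrightarrow> x \<bullet> (B *v x) > 0" and nonneg: "x \<bullet> (C *v x) \<ge> 0" "x \<bullet> (B *v x) \<ge> 0" for x
    using assms(1,2) by (cases "x = 0"; force simp: sym_pos_def_def less_imp_le)+
  have symD: "transpose D = D"
    using assms(1,2) by (auto simp: D_def sym_pos_def_def transpose_def vec_eq_iff)
  have diag: "(D ** M ** D) $ i $ i = (D *v axis i 1) \<bullet> (M *v (D *v axis i 1))" for M i
  proof -
    have "(D ** M ** D) $ i $ i = axis i 1 \<bullet> ((D ** M ** D) *v axis i 1)"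
      by (simp add: inner_axis' column_def matrix_vector_mult_basis)
    then show ?thesis
      by (simp add: matrix_vector_mul_assoc[symmetric] symmetric_matrix_inner[OF symD])
  qed
  have "B ** D + D ** C = 0"
    by (simp add: D_def eq matrix_eq matrix_vector_mul_assoc[symmetric]
        matrix_vector_mult_add_rdistrib matrix_vector_mult_diff_rdistrib
        matrix_vector_mult_diff_distrib)
      (metis eq matrix_vector_mul_assoc)
  then have "D ** (B ** D) + D ** (D ** C) = 0"
    by (simp add: matrix_add_ldistrib[symmetric])
  then have "trace (D ** (B ** D)) + trace (D ** (D ** C)) = 0"
    by (metis trace_add trace_0 mat_0)
  moreover have "trace (D ** (D ** C)) = trace (D ** C ** D)"
    using trace_mul_sym[of D "D ** C"] by simp
  ultimately have tr: "trace (D ** B ** D) + trace (D ** C ** D) = 0"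
    by (simp add: matrix_mul_assoc)
  have "trace (D ** C ** D) \<ge> 0"
    unfolding trace_def diag by (intro sum_nonneg nonneg)
  then have "(\<Sum>i\<in>UNIV. (D *v axis i 1) \<bullet> (B *v (D *v axis i 1))) \<le> 0"
    using tr by (simp add: trace_def diag)
  then have "(D *v axis i 1) \<bullet> (B *v (D *v axis i 1)) = 0" for i
    using sum_nonneg_eq_0_iff[of UNIV "\<lambda>i. (D *v axis i 1) \<bullet> (B *v (D *v axis i 1))"] nonneg(2)
      sum_nonneg[of UNIV "\<lambda>i. (D *v axis i 1) \<bullet> (B *v (D *v axis i 1))"]
    by force
  then have "D *v axis i 1 = 0" for i using pos by (metis less_irrefl)
  then have "D = 0" by (simp add: vec_eq_iff matrix_vector_mult_basis column_def)
  then show ?thesis by (simp add: D_def)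
qed

lemma matrix_sqrt:
  assumes "sym_pos_def A"
  shows "sym_pos_def (matrix_sqrt A)" "matrix_sqrt A ** matrix_sqrt A = A"
proof -
  have "\<exists>!B. sym_pos_def B \<and> B ** B = A"
    using sym_pos_def_sqrt_exists[OF assms] sym_pos_def_sqrt_unique by blast
  from theI'[OF this] show "sym_pos_def (matrix_sqrt A)" "matrix_sqrt A ** matrix_sqrt A = A"
    by (simp_all add: matrix_sqrt_def)
qed

section \<open>Solutions charging only a closed set\<close>

definition subdifferential_on :: "'a::real_inner set \<Rightarrow> ('a \<Rightarrow> real) \<Rightarrow> 'a \<Rightarrow> 'a set" where
  "subdifferential_on S u x = {p. \<forall>y\<in>S. u y \<ge> u x + p \<bullet> (y - x)}"

lemma subdifferential_subset_on: "subdifferential u x \<subseteq> subdifferential_on S u x"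
  by (auto simp: subdifferential_def subdifferential_on_def)

lemma subdifferential_on_halfspaces:
  "subdifferential_on S u x = (\<Inter>y\<in>S. {p. (y - x) \<bullet> p \<le> u y - u x})"
  by (auto simp: subdifferential_on_def inner_commute algebra_simps)

lemma closed_subdifferential_on: "closed (subdifferential_on S u x)"
  unfolding subdifferential_on_halfspaces by (intro closed_INT ballI closed_halfspace_le)

lemma convex_subdifferential_on: "convex (subdifferential_on S u x)"
  unfolding subdifferential_on_halfspaces by (intro convex_INT convex_halfspace_le)

text \<open>A slope supporting at both \<open>x\<close> and \<open>y\<close> lies on the hyperplane
  \<open>p \<bullet> (y - x) = u y - u x\<close>, and moving it towards \<open>y - x\<close> destroys the support at \<open>x\<close>.\<close>

lemma interior_subdifferential_on_disjoint:
  fixes x y :: "'a::real_inner"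
  assumes "x \<in> S" "y \<in> S" "x \<noteq> y"
  shows "interior (subdifferential_on S u x) \<inter> subdifferential_on S u y = {}"
proof (rule ccontr)
  assume "interior (subdifferential_on S u x) \<inter> subdifferential_on S u y \<noteq> {}"
  then obtain p e where p: "p \<in> subdifferential_on S u y" and e: "e > 0"
    and ball: "cball p e \<subseteq> subdifferential_on S u x"
    by (auto simp: mem_interior_cball)
  define q where "q = p + (e / norm (y - x)) *\<^sub>R (y - x)"
  have "q \<in> cball p e"
    using e assms(3) by (simp add: q_def dist_norm)
  then have "u x + q \<bullet> (y - x) \<le> u y"
    using ball assms(2) by (auto simp: subdifferential_on_def)
  moreover have "u y + p \<bullet> (x - y) \<le> u x"
    using p assms(1) by (auto simp: subdifferential_on_def)
  moreover have "p \<bullet> (x - y) = - (p \<bullet> (y - x))" by (simp add: inner_diff_right)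
  moreover have "q \<bullet> (y - x) = p \<bullet> (y - x) + (e / norm (y - x)) * ((y - x) \<bullet> (y - x))"
    by (simp add: q_def inner_add_left)
  moreover have "(e / norm (y - x)) * ((y - x) \<bullet> (y - x)) > 0"
    using e assms(3) by (intro mult_pos_pos) auto
  ultimately show False by linarith
qed

text \<open>The graph of the subdifferential of a continuous function is closed, so compact sets of
  points have closed images, and an open set is a countable union of compact ones. Measurability
  matters below because \<^const>\<open>emeasure\<close> takes the value 0 on every non-measurable set, so that
  the value 0 alone does not make a set null.\<close>

lemma subdifferential_image_open_borel:
  fixes u :: "'a::euclidean_space \<Rightarrow> real"
  assumes cont: "continuous_on UNIV u" and "open U"
  shows "(\<Union>x\<in>U. subdifferential u x) \<in> sets borel"
proof -
  obtain C :: "nat \<Rightarrow> 'a set" where C: "\<And>n. compact (C n)" "(\<Union>n. C n) = U"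
    using open_Union_compact_subsets[OF \<open>open U\<close>] by metis
  have "{(x, p). p \<in> subdifferential u x}
      = (\<Inter>y. {z. u (fst z) + snd z \<bullet> (y - fst z) \<le> u y})"
    by (auto simp: subdifferential_def)
  also have "closed \<dots>"
    by (intro closed_INT ballI closed_Collect_le continuous_intros continuous_on_compose2[OF cont]) auto
  finally have graph: "closed {(x, p). p \<in> subdifferential u x}" .
  have "closed (\<Union>x\<in>C n. subdifferential u x)" for n
  proof -
    have "(\<Union>x\<in>C n. subdifferential u x)
        = {p. \<exists>x. x \<in> C n \<and> (x, p) \<in> {(x, p). p \<in> subdifferential u x}}" by auto
    then show ?thesis using closed_compact_projection[OF C(1) graph] by simp
  qed
  then have "(\<Union>n. \<Union>x\<in>C n. subdifferential u x) \<in> sets borel"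
    by (intro sets.countable_UN) (auto simp: image_subset_iff)
  also have "(\<Union>n. \<Union>x\<in>C n. subdifferential u x) = (\<Union>x\<in>U. subdifferential u x)"
    using C(2) by blast
  finally show ?thesis .
qed

text \<open>A slope in the interior of the cell of \<open>z\<close> that does not support \<open>u\<close> globally at \<open>z\<close>
  supports it at some point off \<open>S\<close>, because distinct cells do not overlap. Such slopes form a
  null set, which therefore cannot contain the open set of all slopes that fail.\<close>

lemma subdifferential_eq_on:
  fixes u :: "'a::euclidean_space \<Rightarrow> real"
  assumes cont: "continuous_on UNIV u" and "closed S"
    and surj: "(\<Union>x. subdifferential u x) = UNIV"
    and null: "emeasure lebesgue (\<Union>x\<in>-S. subdifferential u x) = 0"
    and z: "z \<in> S" and int: "interior (subdifferential_on S u z) \<noteq> {}"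
  shows "subdifferential u z = subdifferential_on S u z"
proof
  show "subdifferential u z \<subseteq> subdifferential_on S u z" by (rule subdifferential_subset_on)
  have closed: "closed (subdifferential u z)"
    using closed_subdifferential_on[of UNIV u z]
    by (simp add: subdifferential_on_def subdifferential_def)
  define D where "D = interior (subdifferential_on S u z) - subdifferential u z"
  have "D \<subseteq> (\<Union>x\<in>-S. subdifferential u x)"
  proof
    fix p assume p: "p \<in> D"
    obtain x where x: "p \<in> subdifferential u x" using surj by blast
    have "x \<notin> S"
    proof
      assume "x \<in> S"
      moreover have "x \<noteq> z" using p x by (auto simp: D_def)
      ultimately show False
        using interior_subdifferential_on_disjoint[OF z, of x u] p x subdifferential_subset_on[of u x S]
        by (auto simp: D_def)
    qed
    then show "p \<in> (\<Union>x\<in>-S. subdifferential u x)" using x by blast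
  qed
  moreover have "negligible (\<Union>x\<in>-S. subdifferential u x)"
    unfolding negligible_iff_null_sets
    using subdifferential_image_open_borel[OF cont, of "-S"] \<open>closed S\<close> null
    by (auto simp: open_Compl intro!: null_setsI)
  ultimately have "negligible D" by (rule negligible_subset[rotated])
  moreover have "open D" unfolding D_def using closed by (intro open_Diff open_interior)
  ultimately have "D = {}" using open_not_negligible by blast
  then have "closure (interior (subdifferential_on S u z)) \<subseteq> subdifferential u z"
    using closed by (intro closure_minimal) (auto simp: D_def)
  then show "subdifferential_on S u z \<subseteq> subdifferential u z"
    using convex_closure_interior[OF convex_subdifferential_on int] closed_subdifferential_on[of S u z]
    by simp
qed

text \<open>The slopes supporting \<open>u\<close> over \<open>S\<close> at \<open>x\<close> are those for which \<open>u - p\<close> is minimal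
  over \<open>S\<close> at \<open>x\<close>; quadratic growth makes the minimum exist.\<close>

lemma subdifferential_on_surj:
  fixes u :: "'a::euclidean_space \<Rightarrow> real"
  assumes cont: "continuous_on UNIV u" and "closed S" "S \<noteq> {}"
    and k: "k > 0" and growth: "\<And>x. u x \<ge> k * (norm x)\<^sup>2 + b \<bullet> x + c"
  shows "(\<Union>x\<in>S. subdifferential_on S u x) = UNIV"
proof -
  have "\<exists>x\<in>S. p \<in> subdifferential_on S u x" for p
  proof -
    define g where "g x = u x - p \<bullet> x" for x
    have contg: "continuous_on UNIV g"
      unfolding g_def using cont by (intro continuous_intros)
    obtain s where s: "s \<in> S" using \<open>S \<noteq> {}\<close> by blast
    \<comment> \<open>Beyond \<open>R\<close> the quadratic term dominates, so \<open>g\<close> is at least its value at \<open>s\<close>; the summand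
      \<open>norm s\<close> puts \<open>s\<close> itself into the ball.\<close>
    define R where "R = 1 + (norm (b - p) + \<bar>g s - c\<bar>) / k + norm s"
    have far: "g s \<le> g x" if "norm x > R" for x
    proof -
      have "norm x \<ge> 1" "k * norm x \<ge> norm (b - p) + \<bar>g s - c\<bar>"
      proof -
        have "norm x \<ge> (norm (b - p) + \<bar>g s - c\<bar>) / k"
          using that norm_ge_zero[of s] unfolding R_def by linarith
        then show "k * norm x \<ge> norm (b - p) + \<bar>g s - c\<bar>"
          using k by (simp add: field_simps)
        have "(norm (b - p) + \<bar>g s - c\<bar>) / k \<ge> 0" using k by simp
        then show "norm x \<ge> 1" using that norm_ge_zero[of s] unfolding R_def by linarith
      qed
      then have "\<bar>g s - c\<bar> * 1 \<le> (k * norm x - norm (b - p)) * norm x"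
        by (intro mult_mono) auto
      also have "\<dots> = k * (norm x)\<^sup>2 - norm (b - p) * norm x"
        by (simp add: algebra_simps power2_eq_square)
      also have "\<dots> \<le> k * (norm x)\<^sup>2 + (b - p) \<bullet> x"
        using Cauchy_Schwarz_ineq2[of "b - p" x] by linarith
      also have "\<dots> \<le> g x - c"
        using growth[of x] by (simp add: g_def inner_diff_left)
      finally show ?thesis using abs_ge_self[of "g s - c"] by simp
    qed
    have "compact (S \<inter> cball 0 R)" using \<open>closed S\<close> by (intro closed_Int_compact) auto
    moreover have "s \<in> S \<inter> cball 0 R"
      using s k by (simp add: R_def)
    moreover have "continuous_on (S \<inter> cball 0 R) g"
      using contg by (rule continuous_on_subset) auto
    ultimately have "\<exists>x\<in>S \<inter> cball 0 R. \<forall>y\<in>S \<inter> cball 0 R. g x \<le> g y"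
      by (intro continuous_attains_inf) auto
    then obtain x where x: "x \<in> S" "\<And>y. y \<in> S \<Longrightarrow> norm y \<le> R \<Longrightarrow> g x \<le> g y" by auto
    have "g x \<le> g y" if "y \<in> S" for y
    proof (cases "norm y \<le> R")
      case False
      then show ?thesis using far[of y] x(2)[OF s] \<open>s \<in> S \<inter> cball 0 R\<close> by auto
    qed (use x that in auto)
    then have "p \<in> subdifferential_on S u x"
      by (auto simp: subdifferential_on_def g_def inner_diff_right algebra_simps)
    then show ?thesis using x(1) by blast
  qed
  then show ?thesis by blast
qed

section \<open>The integer lattice\<close>

lemma integer_lattice_closed: "closed (integer_lattice :: (real^'n) set)"
proof -
  have "integer_lattice = (\<Inter>i. (\<lambda>z::real^'n. z $ i) -` \<int>)"
    by (auto simp: integer_lattice_def)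
  also have "closed \<dots>"
    by (intro closed_INT ballI closed_vimage closed_Ints continuous_intros)
  finally show ?thesis .
qed

lemma integer_lattice_add: "z \<in> integer_lattice \<Longrightarrow> w \<in> integer_lattice \<Longrightarrow> z + w \<in> integer_lattice"
  by (simp add: integer_lattice_def)

lemma integer_lattice_diff: "z \<in> integer_lattice \<Longrightarrow> w \<in> integer_lattice \<Longrightarrow> z - w \<in> integer_lattice"
  by (simp add: integer_lattice_def)

lemma integer_lattice_0: "0 \<in> integer_lattice"
  by (simp add: integer_lattice_def)

lemma integer_lattice_norm_ge_1:
  assumes "z \<in> integer_lattice" "z \<noteq> 0"
  shows "norm z \<ge> 1"
proof -
  obtain i where "z $ i \<noteq> 0" using assms(2) by (auto simp: vec_eq_iff)
  then have "1 \<le> \<bar>z $ i\<bar>"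
    using assms(1) Ints_nonzero_abs_ge1 by (auto simp: integer_lattice_def)
  also have "\<dots> \<le> norm z" by (rule component_le_norm_cart)
  finally show ?thesis .
qed

lemma integer_lattice_periodic_bounded_below:
  fixes v :: "real^'n \<Rightarrow> real"
  assumes cont: "continuous_on UNIV v"
    and per: "\<And>x z. z \<in> integer_lattice \<Longrightarrow> v (x + z) = v x"
  obtains m where "\<And>x. m \<le> v x"
proof -
  define Q where "Q = cbox (0::real^'n) (\<chi> i. 1)"
  have "Q \<noteq> {}" by (auto simp: Q_def interval_ne_empty_cart)
  then obtain x0 where x0: "\<And>y. y \<in> Q \<Longrightarrow> v x0 \<le> v y"
    using continuous_attains_inf[of Q v] continuous_on_subset[OF cont] by (auto simp: Q_def)
  have "v x0 \<le> v x" for x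
  proof -
    \<comment> \<open>Translate \<open>x\<close> into the unit cube by its integer part.\<close>
    define z where "z = (\<chi> i. real_of_int \<lfloor>x $ i\<rfloor>)"
    have "z \<in> integer_lattice" by (simp add: z_def integer_lattice_def)
    then have "v x = v (x - z)" using per[of z "x - z"] by simp
    moreover have "x - z \<in> Q"
      unfolding Q_def mem_box_cart z_def by (simp add: le_floor_iff) linarith
    ultimately show ?thesis using x0 by simp
  qed
  then show thesis using that by blast
qed

lemma emeasure_dirac_sum_Compl:
  fixes S :: "'a::topological_space set"
  assumes "closed S"
  shows "emeasure (dirac_sum S) (-S) = 0"
proof -
  have "-S \<in> sets borel" using assms by (simp add: open_Compl)
  then have "emeasure (dirac_sum S) (-S) = (\<integral>\<^sup>+ z. emeasure (return borel z) (-S) \<partial>count_space S)"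
    by (rule emeasure_dirac_sum)
  also have "\<dots> = (\<integral>\<^sup>+ z. 0 \<partial>count_space S)"
    using \<open>-S \<in> sets borel\<close> by (intro nn_integral_cong) simp
  finally show ?thesis by simp
qed

section \<open>The cell at the origin\<close>

text \<open>The slopes that support \<open>x \<bullet> A x / 2\<close> at the origin when tested against the integer lattice
  only; equivalently, the image under \<open>A\<close> of the Voronoi cell of the integer lattice for the
  inner product defined by \<open>A\<close>, when \<open>A\<close> is symmetric positive definite.\<close>

definition voronoi_cell :: "real^'n^'n \<Rightarrow> (real^'n) set" where
  "voronoi_cell A = {q. \<forall>w\<in>integer_lattice. q \<bullet> w \<le> (1/2) * (w \<bullet> (A *v w))}"

lemma sym_pos_def_inj:
  fixes B :: "real^'n^'n"
  assumes "sym_pos_def B"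
  shows "inj ((*v) B)"
proof -
  have "x = 0" if "B *v x = 0" for x
  proof (rule ccontr)
    assume "x \<noteq> 0"
    then have "x \<bullet> (B *v x) > 0" using assms by (auto simp: sym_pos_def_def)
    then show False using that by simp
  qed
  then show ?thesis
    by (subst linear_injective_0[OF matrix_vector_mul_linear]) blast
qed

text \<open>The form equals \<open>(norm (B x))\<^sup>2\<close> with \<open>B\<close> the square root of \<open>A\<close>, and an injective linear
  map is bounded below.\<close>

lemma sym_pos_def_coercive:
  assumes "sym_pos_def A"
  obtains k where "k > 0" "\<And>x. k * (norm x)\<^sup>2 \<le> x \<bullet> (A *v x)"
proof -
  let ?B = "matrix_sqrt A"
  have B: "sym_pos_def ?B" "?B ** ?B = A" using matrix_sqrt[OF assms] by auto
  have "inj ((*v) ?B)"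
    using B(1) by (rule sym_pos_def_inj)
  then obtain e where e: "e > 0" "\<And>x. e * norm x \<le> norm (?B *v x)"
    using linear_inj_bounded_below_pos[OF matrix_vector_mul_linear] by blast
  have "e\<^sup>2 * (norm x)\<^sup>2 \<le> x \<bullet> (A *v x)" for x
  proof -
    have "(e * norm x)\<^sup>2 \<le> (norm (?B *v x))\<^sup>2" using e by (intro power_mono) auto
    also have "\<dots> = x \<bullet> (?B *v (?B *v x))"
      using symmetric_matrix_inner[of ?B] B(1)
      by (simp add: sym_pos_def_def power2_norm_eq_inner)
    also have "\<dots> = x \<bullet> (A *v x)" by (simp add: matrix_vector_mul_assoc B(2))
    finally show ?thesis by (simp add: power_mult_distrib)
  qed
  then show thesis using that[of "e\<^sup>2"] e(1) by simp
qed

text \<open>Testing against plus and minus each unit vector bounds every coordinate.\<close>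

lemma bounded_voronoi_cell:
  fixes A :: "real^'n^'n"
  shows "bounded (voronoi_cell A)"
proof -
  have bound: "\<bar>q $ i\<bar> \<le> (1/2) * (axis i 1 \<bullet> (A *v axis i 1))" if "q \<in> voronoi_cell A" for q i
  proof -
    let ?e = "axis i 1 :: real^'n"
    have "?e \<in> integer_lattice" "- ?e \<in> integer_lattice"
      by (simp_all add: integer_lattice_def axis_def)
    then have "q \<bullet> ?e \<le> (1/2) * (?e \<bullet> (A *v ?e))" "q \<bullet> (- ?e) \<le> (1/2) * ((- ?e) \<bullet> (A *v (- ?e)))"
      using that unfolding voronoi_cell_def by blast+
    moreover have "A *v (- ?e) = - (A *v ?e)"
      by (rule linear_neg[OF matrix_vector_mul_linear])
    moreover have "q \<bullet> ?e = q $ i" by (simp add: inner_axis)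
    ultimately show ?thesis by (simp add: abs_le_iff)
  qed
  have "voronoi_cell A \<subseteq> cbox (\<chi> i. - ((1/2) * (axis i 1 \<bullet> (A *v axis i 1))))
      (\<chi> i. (1/2) * (axis i 1 \<bullet> (A *v axis i 1)))"
    using bound[unfolded abs_le_iff] by (intro subsetI) (simp add: mem_box_cart minus_le_iff)
  then show ?thesis by (rule bounded_subset[OF bounded_cbox])
qed

text \<open>Nonzero lattice vectors have norm at least 1, so the quadratic bound dominates the linear
  form of every small slope.\<close>

lemma interior_voronoi_cell:
  assumes "sym_pos_def A"
  shows "interior (voronoi_cell A) \<noteq> {}"
proof -
  obtain k where k: "k > 0" "\<And>x. k * (norm x)\<^sup>2 \<le> x \<bullet> (A *v x)"
    using sym_pos_def_coercive[OF assms] by blast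
  have "ball 0 (k / 2) \<subseteq> voronoi_cell A"
  proof
    fix q :: "real^'a" assume q: "q \<in> ball 0 (k / 2)"
    have "q \<bullet> w \<le> (1/2) * (w \<bullet> (A *v w))" if "w \<in> integer_lattice" for w
    proof (cases "w = 0")
      case False
      then have "1 \<le> norm w" using that by (rule integer_lattice_norm_ge_1[rotated])
      have "q \<bullet> w \<le> norm q * norm w" by (rule norm_cauchy_schwarz)
      also have "\<dots> \<le> (k / 2) * norm w" using q by (intro mult_right_mono) auto
      also have "\<dots> \<le> (k / 2) * (norm w)\<^sup>2"
        using k(1) \<open>1 \<le> norm w\<close> by (intro mult_left_mono self_le_power) auto
      also have "\<dots> \<le> (1/2) * (w \<bullet> (A *v w))" using k(2)[of w] by simp
      finally show ?thesis .
    qed simp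
    then show "q \<in> voronoi_cell A" by (auto simp: voronoi_cell_def)
  qed
  then have "ball 0 (k / 2) \<subseteq> interior (voronoi_cell A)" by (simp add: interior_maximal)
  moreover have "0 \<in> ball 0 (k / 2)" using k(1) by simp
  ultimately show ?thesis by blast
qed

text \<open>With \<open>B = A\<^sup>1\<^sup>/\<^sup>2\<close>, the condition \<open>norm y \<le> norm (y - B w)\<close> squares to
  \<open>2 * (B y \<bullet> w) \<le> w \<bullet> A w\<close>.\<close>

lemma voronoi_cell_eq_image:
  fixes A :: "real^'n^'n"
  assumes "sym_pos_def A"
  shows "voronoi_cell A = (*v) (matrix_sqrt A) ` voronoi ((*v) (matrix_sqrt A) ` integer_lattice) 0"
proof -
  let ?B = "matrix_sqrt A"
  have B: "sym_pos_def ?B" "?B ** ?B = A" using matrix_sqrt[OF assms] by auto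
  have symB: "x \<bullet> (?B *v y) = (?B *v x) \<bullet> y" for x y
    using symmetric_matrix_inner[of ?B] B(1) by (simp add: sym_pos_def_def)
  have "inj ((*v) ?B)"
    using B(1) by (rule sym_pos_def_inj)
  then have surj: "surj ((*v) ?B)"
    by (intro linear_injective_imp_surjective matrix_vector_mul_linear) auto
  have "norm y \<le> norm (y - ?B *v w) \<longleftrightarrow> (?B *v y) \<bullet> w \<le> (1/2) * (w \<bullet> (A *v w))" for y w
  proof -
    have "(?B *v w) \<bullet> (?B *v w) = w \<bullet> (A *v w)"
      by (simp add: symB[symmetric] matrix_vector_mul_assoc B(2))
    moreover have "y \<bullet> (?B *v w) = (?B *v y) \<bullet> w" by (rule symB)
    ultimately show ?thesis
      by (simp add: norm_le inner_diff_left inner_diff_right inner_commute[of "?B *v w" y] mult.commute)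
  qed
  then have "y \<in> voronoi ((*v) ?B ` integer_lattice) 0 \<longleftrightarrow> ?B *v y \<in> voronoi_cell A" for y
    by (auto simp: voronoi_def voronoi_cell_def)
  then have "voronoi ((*v) ?B ` integer_lattice) 0 = (*v) ?B -` voronoi_cell A" by auto
  then show ?thesis using surj by (simp add: surj_image_vimage_eq)
qed

text \<open>The periodic part cancels in the increment \<open>u (z + w) - u z\<close>, leaving
  \<open>(b + A z) \<bullet> w + w \<bullet> A w / 2\<close>; the linear term is the translation of the cell.\<close>

lemma subdifferential_on_integer_lattice:
  fixes u v :: "real^'n \<Rightarrow> real"
  assumes u: "\<And>x. u x = v x + (1/2) * (x \<bullet> (A *v x)) + b \<bullet> x + c"
    and per: "\<And>x z. z \<in> integer_lattice \<Longrightarrow> v (x + z) = v x"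
    and sym: "transpose A = A" and z: "z \<in> integer_lattice"
  shows "subdifferential_on integer_lattice u z = (+) (b + A *v z) ` voronoi_cell A"
proof -
  have incr: "u (z + w) - u z = (b + A *v z) \<bullet> w + (1/2) * (w \<bullet> (A *v w))"
    if "w \<in> integer_lattice" for w
  proof -
    have "w \<bullet> (A *v z) = z \<bullet> (A *v w)"
      using symmetric_matrix_inner[OF sym, of z w] by (simp add: inner_commute)
    moreover have "(A *v z) \<bullet> w = z \<bullet> (A *v w)"
      using symmetric_matrix_inner[OF sym, of z w] by simp
    ultimately show ?thesis
      by (simp add: u per[OF that] matrix_vector_right_distrib inner_add_left inner_add_right
          add_divide_distrib)
  qed
  have "p \<in> subdifferential_on integer_lattice u z \<longleftrightarrow> p - (b + A *v z) \<in> voronoi_cell A" for p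
  proof -
    have "p \<in> subdifferential_on integer_lattice u z
        \<longleftrightarrow> (\<forall>w\<in>integer_lattice. u (z + w) \<ge> u z + p \<bullet> w)"
    proof safe
      fix w :: "real^'n" assume w: "w \<in> integer_lattice"
        and p: "p \<in> subdifferential_on integer_lattice u z"
      then show "u z + p \<bullet> w \<le> u (z + w)"
        using integer_lattice_add[OF z w] by (force simp: subdifferential_on_def)
    next
      assume p: "\<forall>w\<in>integer_lattice. u (z + w) \<ge> u z + p \<bullet> w"
      have "u z + p \<bullet> (y - z) \<le> u y" if "y \<in> integer_lattice" for y
        using p integer_lattice_diff[OF that z] by force
      then show "p \<in> subdifferential_on integer_lattice u z" by (simp add: subdifferential_on_def)
    qed
    also have "\<dots> \<longleftrightarrow> (\<forall>w\<in>integer_lattice. (p - (b + A *v z)) \<bullet> w \<le> (1/2) * (w \<bullet> (A *v w)))"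
    proof (intro ball_cong refl)
      fix w :: "real^'n" assume "w \<in> integer_lattice"
      from incr[OF this] show "u z + p \<bullet> w \<le> u (z + w)
          \<longleftrightarrow> (p - (b + A *v z)) \<bullet> w \<le> (1/2) * (w \<bullet> (A *v w))"
        unfolding inner_diff_left by linarith
    qed
    finally show ?thesis by (simp add: voronoi_cell_def)
  qed
  then have "subdifferential_on integer_lattice u z = (\<lambda>p. p - (b + A *v z)) -` voronoi_cell A"
    by blast
  also have "\<dots> = (+) (b + A *v z) ` voronoi_cell A"
    by (force simp: image_iff)
  finally show ?thesis .
qed

section \<open>The tiling\<close>

theorem theorem5p3:
  fixes u v :: "real^'n \<Rightarrow> real" and A :: "real^'n^'n" and b :: "real^'n" and c :: real
    and \<Gamma> :: "(real^'n) set"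
  assumes "alexandrov_solution u (dirac_sum integer_lattice)"
    and "\<And>x. u x = v x + (1/2) * (x \<bullet> (A *v x)) + b \<bullet> x + c"
    and "\<And>x z. z \<in> integer_lattice \<Longrightarrow> v (x + z) = v x"
    and "sym_pos_def A"
    and "\<Gamma> = (*v) (matrix_sqrt A) ` integer_lattice"
  shows "is_tiling integer_lattice (subdifferential u) \<and>
    translation_periodic (subdifferential u ` integer_lattice) ((*v) A ` integer_lattice) \<and>
    (\<forall>z\<in>integer_lattice. \<exists>t. subdifferential u z = (+) t ` ((*v) (matrix_sqrt A) ` voronoi \<Gamma> 0))"
proof -
  let ?L = "integer_lattice :: (real^'n) set"
  have cont: "continuous_on UNIV u"
    using assms(1) by (intro convex_on_continuous) (auto simp: alexandrov_solution_def)
  have null: "emeasure lebesgue (\<Union>x\<in>-?L. subdifferential u x) = 0"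
    using assms(1) emeasure_dirac_sum_Compl[OF integer_lattice_closed]
    by (auto simp: alexandrov_solution_def open_Compl integer_lattice_closed)
  have "continuous_on UNIV (\<lambda>x. u x - (1/2) * (x \<bullet> (A *v x)) - b \<bullet> x - c)"
    by (intro continuous_intros cont linear_continuous_on
        linear_conv_bounded_linear[THEN iffD1] matrix_vector_mul_linear)
  then have "continuous_on UNIV v" by (simp add: assms(2))
  then obtain m where m: "\<And>x. m \<le> v x"
    using integer_lattice_periodic_bounded_below[OF _ assms(3)] by blast
  obtain k where k: "k > 0" "\<And>x. k * (norm x)\<^sup>2 \<le> x \<bullet> (A *v x)"
    using sym_pos_def_coercive[OF assms(4)] by blast
  have growth: "u x \<ge> (k/2) * (norm x)\<^sup>2 + b \<bullet> x + (m + c)" for x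
    using m[of x] k(2)[of x] by (simp add: assms(2))
  \<comment> \<open>Used for \<open>S = UNIV\<close>, where it says that every slope supports \<open>u\<close>, and for the integer lattice,
    where it says that the tiles cover.\<close>
  have surj: "(\<Union>x\<in>S. subdifferential_on S u x) = UNIV" if "closed S" "S \<noteq> {}" for S
    using subdifferential_on_surj[OF cont that _ growth] k(1) by simp
  have "(\<Union>x. subdifferential u x) = UNIV"
    using surj[of UNIV] by (simp add: subdifferential_on_def subdifferential_def)
  note eq_on = subdifferential_eq_on[OF cont integer_lattice_closed this null]
  have sym: "transpose A = A" using assms(4) by (simp add: sym_pos_def_def)
  note cell_on = subdifferential_on_integer_lattice[OF assms(2,3) sym]
  have eq: "subdifferential u z = subdifferential_on ?L u z" if "z \<in> ?L" for z
    using interior_voronoi_cell[OF assms(4)] that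
    by (intro eq_on) (simp_all add: cell_on interior_translation)
  then have cell: "subdifferential u z = (+) (b + A *v z) ` voronoi_cell A" if "z \<in> ?L" for z
    using that by (simp add: cell_on)
  have "is_tiling ?L (subdifferential u)"
    unfolding is_tiling_def
  proof (intro conjI ballI impI)
    fix z assume z: "z \<in> ?L"
    have "bounded (subdifferential u z)"
      unfolding cell[OF z] by (intro bounded_translation bounded_voronoi_cell)
    moreover have "interior (subdifferential u z) \<noteq> {}"
      using interior_voronoi_cell[OF assms(4)] by (simp add: cell[OF z] interior_translation)
    ultimately show "convex_body (subdifferential u z)"
      using convex_subdifferential_on closed_subdifferential_on eq[OF z]
      by (auto simp: convex_body_def compact_eq_bounded_closed)
  next
    show "(\<Union>z\<in>?L. subdifferential u z) = UNIV"
      using surj[OF integer_lattice_closed] integer_lattice_0 eq by auto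
  next
    fix z w assume zw: "z \<in> ?L" "w \<in> ?L" "z \<noteq> w"
    have "interior (subdifferential u z) \<inter> subdifferential u w = {}"
      unfolding eq[OF zw(1)] eq[OF zw(2)] by (rule interior_subdifferential_on_disjoint[OF zw])
    then show "interior (subdifferential u z) \<inter> interior (subdifferential u w) = {}"
      using interior_subset[of "subdifferential u w"] by blast
  qed
  moreover have "translation_periodic (subdifferential u ` ?L) ((*v) A ` ?L)"
    unfolding translation_periodic_def
  proof (intro ballI)
    fix t assume "t \<in> (*v) A ` ?L"
    then obtain w where w: "w \<in> ?L" "t = A *v w" by blast
    have shift: "(+) t ` subdifferential u z = subdifferential u (z + w)" if "z \<in> ?L" for z
      using that w
      by (simp add: cell integer_lattice_add image_image matrix_vector_right_distrib add_ac)
    have "(\<lambda>K. (+) t ` K) ` subdifferential u ` ?L = subdifferential u ` (\<lambda>z. z + w) ` ?L"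
      by (simp add: image_image shift)
    also have "(\<lambda>z. z + w) ` ?L = ?L"
    proof safe
      fix z assume "z \<in> ?L"
      then show "z + w \<in> ?L" using w(1) by (rule integer_lattice_add)
    next
      fix z assume "z \<in> ?L"
      then have "z - w \<in> ?L" using w(1) by (rule integer_lattice_diff)
      then show "z \<in> (\<lambda>z. z + w) ` ?L" by force
    qed
    finally show "(\<lambda>K. (+) t ` K) ` subdifferential u ` ?L = subdifferential u ` ?L" .
  qed
  moreover have "\<forall>z\<in>?L. \<exists>t. subdifferential u z = (+) t ` ((*v) (matrix_sqrt A) ` voronoi \<Gamma> 0)"
    using cell voronoi_cell_eq_image[OF assms(4)] assms(5) by metis
  ultimately show ?thesis by blast
qed

end
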